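(* Let $A$ be a semisimple finite abelian group. Then every finitely generated subgroup of $A \wr \mathbb{Z}$ is hereditarily conjugacy separable. In particular, for every prime $p$, all finitely generated subgroups of the lamplighter group $\mathbb{F}_p \wr \mathbb{Z}$ are hereditarily conjugacy separable.
   Context: A finite abelian group is semisimple if it is a direct sum of cyclic groups of prime order. $A \wr \mathbb{Z}$ is the restricted wreath product $\left(\bigoplus_{\mathbb{Z}} A\right)\rtimes \mathbb{Z}$ with $\mathbb{Z}$ acting by shifting coordinates; in $\mathbb{F}_p\wr\mathbb{Z}$, $\mathbb{F}_p$ stands for its additive group. A group $G$ is conjugacy separable if for every pair of non-conjugate elements $f,g \in G$ there is a surjective homomorphism $\pi$ onto a finite group such that $\pi(f)$ and $\pi(g)$ are not conjugate in the image. $G$ is hereditarily conjugacy separable if $G$ and each of its finite-index subgroups are conjugacy separable. *)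

theory Defs
  imports "HOL-Algebra.Product_Groups" "HOL-Algebra.Elementary_Groups" "HOL-Number_Theory.Residues"
begin

section \<open>Semisimple finite abelian groups\<close>

text \<open>Asking for summands with elements in the type of \<open>A\<close> is no restriction: in any direct
  sum decomposition the summands embed into \<open>A\<close>. The trivial group is the empty direct sum.\<close>

definition semisimple_group :: "('a, 'b) monoid_scheme \<Rightarrow> bool" where
  "semisimple_group A \<longleftrightarrow>
     comm_group A \<and> finite (carrier A) \<and>
     (\<exists>(I :: nat set) (C :: nat \<Rightarrow> 'a monoid).
        finite I \<and>
        (\<forall>i\<in>I. group (C i) \<and> cyclic_group (C i) \<and> Factorial_Ring.prime (order (C i))) \<and>
        A \<cong> sum_group I C)"

section \<open>Restricted wreath products with the integers\<close>

definition semidirect_product ::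
  "('a, 'c) monoid_scheme \<Rightarrow> ('b, 'd) monoid_scheme \<Rightarrow> ('b \<Rightarrow> 'a \<Rightarrow> 'a) \<Rightarrow> ('a \<times> 'b) monoid" where
  "semidirect_product N H \<phi> =
     \<lparr>carrier = carrier N \<times> carrier H,
      monoid.mult = (\<lambda>(x, h) (y, k). (x \<otimes>\<^bsub>N\<^esub> \<phi> h y, h \<otimes>\<^bsub>H\<^esub> k)),
      one = (\<one>\<^bsub>N\<^esub>, \<one>\<^bsub>H\<^esub>)\<rparr>"

definition wreath_int :: "('a, 'b) monoid_scheme \<Rightarrow> ((int \<Rightarrow> 'a) \<times> int) monoid" where
  "wreath_int A =
     semidirect_product (sum_group (UNIV :: int set) (\<lambda>_. A)) integer_group (\<lambda>k x i. x (i - k))"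

lemma group_semidirect_product:
  assumes "group N" "group H"
    and aut: "\<And>h. h \<in> carrier H \<Longrightarrow> \<phi> h \<in> hom N N"
    and one: "\<And>x. x \<in> carrier N \<Longrightarrow> \<phi> \<one>\<^bsub>H\<^esub> x = x"
    and mult: "\<And>h k x. \<lbrakk>h \<in> carrier H; k \<in> carrier H; x \<in> carrier N\<rbrakk>
                 \<Longrightarrow> \<phi> (h \<otimes>\<^bsub>H\<^esub> k) x = \<phi> h (\<phi> k x)"
  shows "group (semidirect_product N H \<phi>)"
proof -
  interpret N: group N by fact
  interpret H: group H by fact
  have cl: "\<phi> h x \<in> carrier N" if "h \<in> carrier H" "x \<in> carrier N" for h x
    using hom_in_carrier[OF aut] that by blast
  have hm: "\<phi> h (x \<otimes>\<^bsub>N\<^esub> y) = \<phi> h x \<otimes>\<^bsub>N\<^esub> \<phi> h y"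
    if "h \<in> carrier H" "x \<in> carrier N" "y \<in> carrier N" for h x y
    using hom_mult[OF aut] that by blast
  have linv: "\<exists>y\<in>carrier (semidirect_product N H \<phi>).
      y \<otimes>\<^bsub>semidirect_product N H \<phi>\<^esub> p = \<one>\<^bsub>semidirect_product N H \<phi>\<^esub>"
    if "p \<in> carrier (semidirect_product N H \<phi>)" for p
  proof -
    obtain x h where p: "p = (x, h)" "x \<in> carrier N" "h \<in> carrier H"
      using \<open>p \<in> carrier _\<close> by (auto simp: semidirect_product_def)
    show ?thesis
      using p by (intro bexI[of _ "(inv\<^bsub>N\<^esub> (\<phi> (inv\<^bsub>H\<^esub> h) x), inv\<^bsub>H\<^esub> h)"])
        (auto simp: semidirect_product_def cl)
  qed
  show ?thesis
    by (rule groupI; (erule linv)?)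
      (auto simp: semidirect_product_def cl hm one mult N.m_assoc H.m_assoc)
qed

lemma group_wreath_int:
  assumes "group A"
  shows "group (wreath_int A)"
proof -
  let ?N = "sum_group (UNIV :: int set) (\<lambda>_. A)"
  have fin: "finite {i. x (i - k) \<noteq> \<one>\<^bsub>A\<^esub>}" if "finite {i. x i \<noteq> \<one>\<^bsub>A\<^esub>}"
    for x :: "int \<Rightarrow> 'a" and k :: int
  proof -
    have "{i. x (i - k) \<noteq> \<one>\<^bsub>A\<^esub>} = (\<lambda>i. i + k) ` {i. x i \<noteq> \<one>\<^bsub>A\<^esub>}"
      by (force simp: image_iff)
    then show ?thesis using that by simp
  qed
  show ?thesis
    unfolding wreath_int_def
  proof (rule group_semidirect_product)
    show "(\<lambda>x i. x (i - k)) \<in> hom ?N ?N" for k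
      by (rule homI) (auto simp: carrier_sum_group assms fin PiE_def Pi_def)
  qed (use assms in \<open>simp_all add: diff_diff_eq2 diff_diff_eq\<close>)
qed

section \<open>Conjugacy separability\<close>

definition conjugate_in :: "('a, 'b) monoid_scheme \<Rightarrow> 'a \<Rightarrow> 'a \<Rightarrow> bool" where
  "conjugate_in G f g \<longleftrightarrow> (\<exists>x\<in>carrier G. g = x \<otimes>\<^bsub>G\<^esub> f \<otimes>\<^bsub>G\<^esub> inv\<^bsub>G\<^esub> x)"

text \<open>The finite quotients range over groups with elements in \<^typ>\<open>nat\<close>; every finite group is
  isomorphic to such a group, so by \<open>separating_quotient_nat\<close> below finite quotients in any
  other type yield one of this form.\<close>

definition conjugacy_separable :: "('a, 'b) monoid_scheme \<Rightarrow> bool" where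
  "conjugacy_separable G \<longleftrightarrow>
     (\<forall>f\<in>carrier G. \<forall>g\<in>carrier G. \<not> conjugate_in G f g \<longrightarrow>
        (\<exists>(Q :: nat monoid) \<pi>. group Q \<and> finite (carrier Q) \<and> \<pi> \<in> epi G Q \<and>
                              \<not> conjugate_in Q (\<pi> f) (\<pi> g)))"

definition hereditarily_conjugacy_separable :: "('a, 'b) monoid_scheme \<Rightarrow> bool" where
  "hereditarily_conjugacy_separable G \<longleftrightarrow>
     conjugacy_separable G \<and>
     (\<forall>K. subgroup K G \<and> finite (rcosets\<^bsub>G\<^esub> K) \<longrightarrow> conjugacy_separable (G\<lparr>carrier := K\<rparr>))"

definition finitely_generated_subgroup :: "'a set \<Rightarrow> ('a, 'b) monoid_scheme \<Rightarrow> bool" where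
  "finitely_generated_subgroup H G \<longleftrightarrow>
     (\<exists>S. finite S \<and> S \<subseteq> carrier G \<and> H = generate G S)"

lemma separating_quotient_nat:
  fixes G :: "('a, 'b) monoid_scheme" and Q :: "('c, 'd) monoid_scheme"
  assumes "group Q" "finite (carrier Q)" "\<pi> \<in> epi G Q"
    and "f \<in> carrier G" "g \<in> carrier G" "\<not> conjugate_in Q (\<pi> f) (\<pi> g)"
  shows "\<exists>(Q' :: nat monoid) \<pi>'. group Q' \<and> finite (carrier Q') \<and> \<pi>' \<in> epi G Q' \<and>
           \<not> conjugate_in Q' (\<pi>' f) (\<pi>' g)"
proof -
  interpret Q: group Q by fact
  obtain e :: "'c \<Rightarrow> nat" where e: "inj_on e (carrier Q)"
    using finite_imp_inj_to_nat_seg[OF assms(2)] by blast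
  define d where "d = inv_into (carrier Q) e"
  have d: "d (e x) = x" if "x \<in> carrier Q" for x
    using that e by (simp add: d_def)
  define Q' where "Q' = \<lparr>carrier = e ` carrier Q,
    monoid.mult = (\<lambda>x y. e (d x \<otimes>\<^bsub>Q\<^esub> d y)), one = e \<one>\<^bsub>Q\<^esub>\<rparr>"
  have linv: "\<exists>y\<in>carrier Q'. y \<otimes>\<^bsub>Q'\<^esub> x = \<one>\<^bsub>Q'\<^esub>" if "x \<in> carrier Q'" for x
  proof -
    obtain z where z: "x = e z" "z \<in> carrier Q"
      using \<open>x \<in> carrier Q'\<close> by (auto simp: Q'_def)
    show ?thesis
      using z by (intro bexI[of _ "e (inv\<^bsub>Q\<^esub> z)"]) (auto simp: Q'_def d)
  qed
  have carQ': "carrier Q' = e ` carrier Q"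
    by (simp add: Q'_def)
  have fin: "finite (carrier Q')"
    using assms(2) by (simp add: Q'_def)
  have gr: "group Q'"
    by (rule groupI; (erule linv)?) (auto simp: Q'_def d Q.m_assoc)
  have \<pi>: "\<pi> \<in> hom G Q" "\<pi> ` carrier G = carrier Q"
    using assms(3) by (auto simp: epi_def)
  have eh: "e \<in> hom Q Q'"
    by (rule homI) (auto simp: Q'_def d)
  have einv: "inv\<^bsub>Q'\<^esub> (e x) = e (inv\<^bsub>Q\<^esub> x)" if "x \<in> carrier Q" for x
    using that eh gr assms(1)
    by (intro group_hom.hom_inv[symmetric]) (simp_all add: group_hom_def group_hom_axioms_def)
  have "(e \<circ> \<pi>) ` carrier G = carrier Q'"
    unfolding image_comp[symmetric] \<pi>(2) by (simp add: Q'_def)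
  then have "e \<circ> \<pi> \<in> epi G Q'"
    using hom_compose[OF \<pi>(1) eh] by (simp add: epi_def)
  moreover have "\<not> conjugate_in Q' (e (\<pi> f)) (e (\<pi> g))"
  proof
    assume "conjugate_in Q' (e (\<pi> f)) (e (\<pi> g))"
    then obtain x where x: "x \<in> carrier Q"
      "e (\<pi> g) = e x \<otimes>\<^bsub>Q'\<^esub> e (\<pi> f) \<otimes>\<^bsub>Q'\<^esub> inv\<^bsub>Q'\<^esub> (e x)"
      unfolding conjugate_in_def by (auto simp: carQ')
    have c: "\<pi> f \<in> carrier Q" "\<pi> g \<in> carrier Q"
      using \<pi> assms by auto
    have "e (\<pi> g) = e (x \<otimes>\<^bsub>Q\<^esub> \<pi> f \<otimes>\<^bsub>Q\<^esub> inv\<^bsub>Q\<^esub> x)"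
      unfolding x(2) using x(1) c by (simp add: einv hom_mult[OF eh])
    then have "\<pi> g = x \<otimes>\<^bsub>Q\<^esub> \<pi> f \<otimes>\<^bsub>Q\<^esub> inv\<^bsub>Q\<^esub> x"
      by (rule inj_onD[OF e]) (use x(1) c in simp_all)
    then show False
      using assms(6) x(1) by (auto simp: conjugate_in_def)
  qed
  ultimately show ?thesis
    using gr fin by (intro exI[of _ Q'] exI[of _ "e \<circ> \<pi>"]) simp
qed

end

theory Submission
  imports Defs
begin

text \<open>
  Let \<open>W = B \<rtimes> \<int>\<close> be the wreath product, where \<open>B\<close> is the base group with the shift \<open>T\<close>.
  A finitely generated subgroup of \<open>B\<close> is finite. Any other finitely generated subgroup, and each of
  its finite-index subgroups, has nontrivial image in \<open>\<int>\<close>, hence splits as \<open>M \<rtimes> \<int>\<close> with \<open>M \<le> B\<close>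
  and generator acting as \<open>t = T\<^sup>m\<close>. In additive notation, elements \<open>(u, n)\<close> and \<open>(w, n)\<close> of
  \<open>M \<rtimes> \<int>\<close> are conjugate iff \<open>w - t\<^sup>l u \<in> (1 - t\<^sup>n) M\<close> for some \<open>l\<close>.

  Non-conjugate elements are separated modulo \<open>(1 - t\<^sup>k) M \<rtimes> k\<int>\<close> for a suitable \<open>k > 0\<close>: if the
  \<open>\<int>\<close>-components differ, any \<open>k\<close> not dividing their difference will do; if both equal \<open>n \<noteq> 0\<close>, take
  \<open>k = \<bar>n\<bar>\<close>; if both vanish, take \<open>k\<close> so large that \<open>w\<close> and a suitable translate of \<open>u\<close> live in a
  window that contains the support of no nonzero element of \<open>(1 - t\<^sup>k) B\<close>.
  The index of \<open>(1 - T\<^sup>k) M\<close> in \<open>M\<close> is finite by counting: if \<open>M\<^sub>n\<close> is the set of elements of \<open>M\<close>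
  supported in a window of length \<open>n\<close>, then \<open>r\<close> inequivalent elements of \<open>M\<close> give
  \<open>r * card M\<^sub>n \<le> card M\<^bsub>n+k\<^esub> \<le> card A ^ k * card M\<^sub>n\<close> for large \<open>n\<close>.
\<close>

section \<open>Criteria for conjugacy separability\<close>

text \<open>If the images of \<open>f\<close> and \<open>g\<close> in \<open>G Mod N\<close> are
  conjugate by the coset of \<open>h\<close>, then \<open>h f h^-1\<close> and \<open>g\<close> lie
  in the same coset of \<open>N\<close>. So for each non-conjugate pair it suffices to find a normal
  subgroup of finite index that contains none of the products \<open>h f h^-1 g^-1\<close>.\<close>

lemma conjugacy_separableI:
  assumes "group G"
    and sep: "\<And>f g. \<lbrakk>f \<in> carrier G; g \<in> carrier G; \<not> conjugate_in G f g\<rbrakk> \<Longrightarrow>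
      \<exists>N. N \<lhd> G \<and> finite (rcosets\<^bsub>G\<^esub> N) \<and>
        (\<forall>h\<in>carrier G. h \<otimes>\<^bsub>G\<^esub> f \<otimes>\<^bsub>G\<^esub> inv\<^bsub>G\<^esub> h \<otimes>\<^bsub>G\<^esub> inv\<^bsub>G\<^esub> g \<notin> N)"
  shows "conjugacy_separable G"
  unfolding conjugacy_separable_def
proof (intro ballI impI)
  interpret group G by fact
  fix f g assume f: "f \<in> carrier G" and g: "g \<in> carrier G" and nc: "\<not> conjugate_in G f g"
  then obtain N where N: "N \<lhd> G" "finite (rcosets\<^bsub>G\<^esub> N)"
    "\<And>h. h \<in> carrier G \<Longrightarrow> h \<otimes>\<^bsub>G\<^esub> f \<otimes>\<^bsub>G\<^esub> inv\<^bsub>G\<^esub> h \<otimes>\<^bsub>G\<^esub> inv\<^bsub>G\<^esub> g \<notin> N"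
    using sep by meson
  interpret N: normal N G by fact
  interpret Q: group "G Mod N" by (rule N.factorgroup_is_group)
  let ?\<pi> = "\<lambda>a. N #>\<^bsub>G\<^esub> a"
  have hom: "?\<pi> \<in> hom G (G Mod N)" by (rule N.r_coset_hom_Mod)
  interpret h: group_hom G "G Mod N" ?\<pi>
    by unfold_locales (rule hom)
  have car: "carrier (G Mod N) = ?\<pi> ` carrier G"
    by (auto simp: FactGroup_def RCOSETS_def)
  have "\<not> conjugate_in (G Mod N) (?\<pi> f) (?\<pi> g)"
  proof
    assume "conjugate_in (G Mod N) (?\<pi> f) (?\<pi> g)"
    then obtain h where h: "h \<in> carrier G"
      and eq: "?\<pi> g = ?\<pi> h \<otimes>\<^bsub>G Mod N\<^esub> ?\<pi> f \<otimes>\<^bsub>G Mod N\<^esub> inv\<^bsub>G Mod N\<^esub> (?\<pi> h)"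
      unfolding conjugate_in_def car by blast
    from eq have "?\<pi> g = ?\<pi> (h \<otimes>\<^bsub>G\<^esub> f \<otimes>\<^bsub>G\<^esub> inv\<^bsub>G\<^esub> h)" (is "_ = _ #>\<^bsub>_\<^esub> ?c")
      using f h by (simp only: h.hom_inv[symmetric] h.hom_mult[symmetric] inv_closed m_closed)
    moreover have "?c \<in> ?\<pi> ?c"
      using f h by (intro rcos_self N.is_subgroup) simp
    ultimately have "?c \<in> ?\<pi> g" by simp
    then have "h \<otimes>\<^bsub>G\<^esub> f \<otimes>\<^bsub>G\<^esub> inv\<^bsub>G\<^esub> h \<otimes>\<^bsub>G\<^esub> inv\<^bsub>G\<^esub> g \<in> N"
      using N.rcos_module_imp[OF is_group g] f h by simp
    then show False using N(3)[OF h] by simp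
  qed
  then show "\<exists>(Q :: nat monoid) \<pi>. group Q \<and> finite (carrier Q) \<and> \<pi> \<in> epi G Q \<and>
                              \<not> conjugate_in Q (\<pi> f) (\<pi> g)"
    using N(2) hom f g
    by (intro separating_quotient_nat[of "G Mod N" ?\<pi>])
       (auto simp: epi_def car Q.is_group, simp_all add: FactGroup_def flip: car)
qed

text \<open>The identity map already separates; \<open>separating_quotient_nat\<close> moves its
  target to \<open>nat\<close>.\<close>

lemma conjugacy_separable_finite:
  assumes "group G" "finite (carrier G)"
  shows "conjugacy_separable G"
  unfolding conjugacy_separable_def
  using assms by (intro ballI impI separating_quotient_nat[of G id])
    (auto simp: epi_def hom_def)

text \<open>Separating quotients pull back along \<open>\<psi>\<close>. This allows subgroups of the
  wreath product to be replaced by isomorphic semidirect products.\<close>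

lemma conjugacy_separable_iso:
  assumes "group G" "group H" "\<psi> \<in> iso G H" "conjugacy_separable H"
  shows "conjugacy_separable G"
  unfolding conjugacy_separable_def
proof (intro ballI impI)
  interpret G: group G by fact
  interpret H: group H by fact
  have hom: "\<psi> \<in> hom G H" and bij: "bij_betw \<psi> (carrier G) (carrier H)"
    using assms(3) by (auto simp: iso_def)
  interpret \<psi>: group_hom G H \<psi> by unfold_locales (rule hom)
  have im: "\<psi> ` carrier G = carrier H" and inj: "inj_on \<psi> (carrier G)"
    using bij by (auto simp: bij_betw_def)
  fix f g assume fg: "f \<in> carrier G" "g \<in> carrier G" and nc: "\<not> conjugate_in G f g"
  have "\<not> conjugate_in H (\<psi> f) (\<psi> g)"
  proof
    assume "conjugate_in H (\<psi> f) (\<psi> g)"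
    then obtain x where x: "x \<in> carrier G" "\<psi> g = \<psi> x \<otimes>\<^bsub>H\<^esub> \<psi> f \<otimes>\<^bsub>H\<^esub> inv\<^bsub>H\<^esub> \<psi> x"
      unfolding conjugate_in_def im[symmetric] by blast
    then have "\<psi> g = \<psi> (x \<otimes>\<^bsub>G\<^esub> f \<otimes>\<^bsub>G\<^esub> inv\<^bsub>G\<^esub> x)"
      using fg by simp
    then have "g = x \<otimes>\<^bsub>G\<^esub> f \<otimes>\<^bsub>G\<^esub> inv\<^bsub>G\<^esub> x"
      by (rule inj_onD[OF inj]) (use fg x in auto)
    with nc x(1) show False by (auto simp: conjugate_in_def)
  qed
  then obtain Q :: "nat monoid" and \<pi> where Q: "group Q" "finite (carrier Q)" "\<pi> \<in> epi H Q"
    "\<not> conjugate_in Q (\<pi> (\<psi> f)) (\<pi> (\<psi> g))"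
    using assms(4) fg unfolding conjugacy_separable_def by (meson \<psi>.hom_closed)
  have "\<pi> \<circ> \<psi> \<in> epi G Q"
    using hom_compose[OF hom, of \<pi> Q] Q(3) image_comp[of \<pi> \<psi> "carrier G"]
    by (simp add: epi_def im)
  with Q show "\<exists>(Q :: nat monoid) \<pi>. group Q \<and> finite (carrier Q) \<and> \<pi> \<in> epi G Q \<and>
                              \<not> conjugate_in Q (\<pi> f) (\<pi> g)"
    by (metis comp_apply)
qed

section \<open>Semidirect products of abelian groups with the integers\<close>

text \<open>An action of the integers by automorphisms: \<open>T_0\<close> and \<open>T_add\<close>
  make \<open>T (- n)\<close> inverse to \<open>T n\<close>.\<close>

locale int_action = comm_group B for B (structure) +
  fixes T :: "int \<Rightarrow> 'a \<Rightarrow> 'a"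
  assumes T_hom: "T n \<in> hom B B"
    and T_0: "x \<in> carrier B \<Longrightarrow> T 0 x = x"
    and T_add: "x \<in> carrier B \<Longrightarrow> T (m + n) x = T m (T n x)"
begin

lemma T_closed [simp]: "x \<in> carrier B \<Longrightarrow> T n x \<in> carrier B"
  using T_hom by (auto simp: hom_def)

lemma T_mult [simp]: "\<lbrakk>x \<in> carrier B; y \<in> carrier B\<rbrakk> \<Longrightarrow> T n (x \<otimes> y) = T n x \<otimes> T n y"
  using T_hom by (auto simp: hom_def)

lemma T_one [simp]: "T n \<one> = \<one>"
  using hom_one[OF T_hom] by (simp add: is_group)

lemma T_inv [simp]: "x \<in> carrier B \<Longrightarrow> T n (inv x) = inv (T n x)"
  using T_hom by (intro group_hom.hom_inv) (auto simp: group_hom_def group_hom_axioms_def is_group)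

lemma T_T: "x \<in> carrier B \<Longrightarrow> T m (T n x) = T (m + n) x"
  by (simp add: T_add)

section \<open>Multiplication and conjugation in the semidirect product\<close>

abbreviation S where "S \<equiv> semidirect_product B integer_group T"

lemma group_S: "group S"
  by (rule group_semidirect_product) (auto simp: is_group T_hom T_0 T_add)

lemma carrier_S: "carrier S = carrier B \<times> UNIV"
  by (simp add: semidirect_product_def)

lemma one_S: "\<one>\<^bsub>S\<^esub> = (\<one>, 0)"
  by (simp add: semidirect_product_def)

lemma mult_S: "(x, h) \<otimes>\<^bsub>S\<^esub> (y, k) = (x \<otimes> T h y, h + k)"
  by (simp add: semidirect_product_def)

lemma inv_S:
  assumes "x \<in> carrier B"
  shows "inv\<^bsub>S\<^esub> (x, h) = (inv (T (- h) x), - h)"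
  by (rule group.inv_equality[OF group_S])
    (use assms in \<open>auto simp: mult_S one_S carrier_S T_T T_0\<close>)

text \<open>Conjugation by \<open>(z, l)\<close> translates \<open>x\<close> by \<open>T l\<close>
  and adds the coboundary of \<open>z\<close> for \<open>1 - T n\<close>; the action of
  \<open>l\<close> on the inverse cancels, so \<open>z\<close> meets only
  \<open>T n\<close>.\<close>

lemma conj_S:
  assumes "x \<in> carrier B" "z \<in> carrier B"
  shows "(z, l) \<otimes>\<^bsub>S\<^esub> (x, n) \<otimes>\<^bsub>S\<^esub> inv\<^bsub>S\<^esub> (z, l) = (z \<otimes> inv (T n z) \<otimes> T l x, n)"
  using assms by (simp add: mult_S inv_S T_T m_ac)

text \<open>The image of \<open>1 - T\<^sup>k\<close>, written multiplicatively.\<close>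

definition cob :: "int \<Rightarrow> 'a set" where
  "cob k = (\<lambda>v. v \<otimes> inv (T k v)) ` carrier B"

lemma cobI: "v \<in> carrier B \<Longrightarrow> v \<otimes> inv (T k v) \<in> cob k"
  by (auto simp: cob_def)

lemma cobE:
  assumes "x \<in> cob k"
  obtains v where "v \<in> carrier B" "x = v \<otimes> inv (T k v)"
  using assms unfolding cob_def by blast

lemma cob_closed: "x \<in> cob k \<Longrightarrow> x \<in> carrier B"
  by (auto simp: cob_def)

lemma subgroup_cob: "subgroup (cob k) B"
proof -
  have "group_hom B B (\<lambda>v. v \<otimes> inv (T k v))"
    by unfold_locales (auto simp: hom_def m_ac inv_mult)
  from group_hom.img_is_subgroup[OF this] show ?thesis by (simp add: cob_def)
qed

lemma T_cob: "x \<in> cob k \<Longrightarrow> T n x \<in> cob k"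
proof -
  assume "x \<in> cob k"
  then obtain v where v: "v \<in> carrier B" "x = v \<otimes> inv (T k v)" by (auto simp: cob_def)
  then have "T n x = T n v \<otimes> inv (T k (T n v))"
    by (simp add: T_T add.commute)
  with v show ?thesis by (simp add: cobI)
qed

section \<open>Congruence modulo coboundaries\<close>

lemma telescope:
  "\<lbrakk>u \<in> carrier B; a \<in> carrier B; b \<in> carrier B\<rbrakk>
    \<Longrightarrow> u \<otimes> inv b = (u \<otimes> inv a) \<otimes> (a \<otimes> inv b)"
  by (simp add: m_assoc) (simp add: m_assoc[symmetric])

lemma cob_trans:
  assumes "u \<in> carrier B" "a \<in> carrier B" "b \<in> carrier B"
    and "u \<otimes> inv a \<in> cob k" "a \<otimes> inv b \<in> cob k"
  shows "u \<otimes> inv b \<in> cob k"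
  using assms telescope[of u a b] subgroup.m_closed[OF subgroup_cob] by metis

lemma cob_sym:
  assumes "u \<in> carrier B" "a \<in> carrier B" and "u \<otimes> inv a \<in> cob k"
  shows "a \<otimes> inv u \<in> cob k"
  using subgroup.m_inv_closed[OF subgroup_cob assms(3)] assms(1,2)
  by (simp add: inv_mult m_comm)

text \<open>The operator \<open>1 - T (k * j)\<close> is divisible by \<open>1 - T k\<close>, as in
  a geometric series. The induction on \<open>j\<close> telescopes in both directions, so negative
  \<open>j\<close> is covered.\<close>

lemma cob_geometric:
  assumes "u \<in> carrier B"
  shows "u \<otimes> inv (T (k * j) u) \<in> cob k"
proof (induction j rule: int_induct[where k = 0])
  case base
  then show ?case using assms subgroup.one_closed[OF subgroup_cob] by (simp add: T_0)
next
  case (step1 j)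
  have "T (k * j) u \<otimes> inv (T (k * (j + 1)) u) \<in> cob k"
    using cobI[of "T (k * j) u" k] assms by (simp add: T_T algebra_simps)
  with step1 show ?case using assms by (blast intro: cob_trans T_closed)
next
  case (step2 j)
  have "T (k * (j - 1)) u \<otimes> inv (T (k * j) u) \<in> cob k"
    using cobI[of "T (k * (j - 1)) u" k] assms by (simp add: T_T algebra_simps)
  with step2 show ?case using assms by (blast intro: cob_trans cob_sym T_closed)
qed

section \<open>Congruence subgroups and the separation theorem\<close>

text \<open>Modulo \<open>cob k\<close> the operator \<open>T k\<close> becomes trivial, so the
  integers modulo \<open>k\<close> act on that quotient of \<open>B\<close>; \<open>con k\<close> is
  the kernel of the map from \<open>S\<close> to the resulting semidirect product.\<close>

definition con :: "int \<Rightarrow> ('a \<times> int) set" where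
  "con k = cob k \<times> {n. k dvd n}"

text \<open>In \<open>conj_S\<close> the coboundary of \<open>z\<close> lies in \<open>cob k\<close>
  by \<open>cob_geometric\<close>, because \<open>k\<close> divides \<open>n\<close>; the translate
  of \<open>x\<close> lies there by \<open>T_cob\<close>.\<close>

lemma con_normal: "con k \<lhd> S"
proof -
  interpret S: group S by (rule group_S)
  have inv_cob: "\<And>x. x \<in> cob k \<Longrightarrow> inv x \<in> cob k"
    using subgroup.m_inv_closed[OF subgroup_cob] by blast
  have mult_cob: "\<And>x y. x \<in> cob k \<Longrightarrow> y \<in> cob k \<Longrightarrow> x \<otimes> y \<in> cob k"
    using subgroup.m_closed[OF subgroup_cob] by blast
  have "subgroup (con k) S"
  proof (rule S.subgroupI)
    show "con k \<subseteq> carrier S" by (auto simp: con_def carrier_S cob_closed)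
    show "con k \<noteq> {}"
      using subgroup.one_closed[OF subgroup_cob] by (auto simp: con_def)
  qed (auto simp: con_def inv_S mult_S cob_closed T_cob inv_cob mult_cob)
  moreover have "(z, l) \<otimes>\<^bsub>S\<^esub> (x, n) \<otimes>\<^bsub>S\<^esub> inv\<^bsub>S\<^esub> (z, l) \<in> con k"
    if "z \<in> carrier B" "(x, n) \<in> con k" for z l x n
  proof -
    obtain j where "n = k * j" using \<open>(x, n) \<in> con k\<close> by (auto simp: con_def)
    then have "z \<otimes> inv (T n z) \<in> cob k" using cob_geometric[OF \<open>z \<in> carrier B\<close>] by simp
    with that show ?thesis
      by (auto simp: con_def conj_S cob_closed T_cob mult_cob)
  qed
  ultimately show ?thesis
    unfolding S.normal_inv_iff by (auto simp: carrier_S)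
qed

text \<open>Each coset has a representative \<open>(r, n mod k)\<close> with \<open>r\<close> in
  \<open>R\<close>. The twist by \<open>T (n - n mod k)\<close> that arises in the quotient of two
  elements is harmless by \<open>cob_geometric\<close>.\<close>

lemma finite_rcosets_con:
  assumes "k > 0" "finite R" "R \<subseteq> carrier B"
    and cover: "\<And>u. u \<in> carrier B \<Longrightarrow> \<exists>r\<in>R. u \<otimes> inv r \<in> cob k"
  shows "finite (rcosets\<^bsub>S\<^esub> con k)"
proof (rule finite_subset)
  interpret S: group S by (rule group_S)
  interpret N: normal "con k" S by (rule con_normal)
  show "rcosets\<^bsub>S\<^esub> con k \<subseteq> (\<lambda>g. con k #>\<^bsub>S\<^esub> g) ` (R \<times> {0..<k})"
  proof
    fix C assume "C \<in> rcosets\<^bsub>S\<^esub> con k"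
    then obtain u n where u: "u \<in> carrier B" and C: "C = con k #>\<^bsub>S\<^esub> (u, n)"
      by (auto simp: RCOSETS_def carrier_S)
    obtain r where r: "r \<in> R" "u \<otimes> inv r \<in> cob k" using cover[OF u] by blast
    have rB: "r \<in> carrier B" using r assms(3) by blast
    let ?n = "n mod k"
    have kd: "n - ?n = k * (n div k)" by (simp add: minus_mod_eq_mult_div)
    have "u \<otimes> inv (T (n - ?n) r) \<in> cob k"
      unfolding kd using cob_trans[OF u rB _ r(2) cob_geometric[OF rB]] rB by simp
    then have "(u, n) \<otimes>\<^bsub>S\<^esub> inv\<^bsub>S\<^esub> (r, ?n) \<in> con k"
      using u rB by (simp add: con_def mult_S inv_S T_T)
    then have "(u, n) \<in> con k #>\<^bsub>S\<^esub> (r, ?n)"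
      using u rB by (intro N.rcos_module_rev[OF S.is_group]) (auto simp: carrier_S)
    then have "C = con k #>\<^bsub>S\<^esub> (r, ?n)"
      unfolding C using rB
      by (intro S.repr_independence[symmetric] N.is_subgroup) (auto simp: carrier_S)
    with r(1) \<open>k > 0\<close> show "C \<in> (\<lambda>g. con k #>\<^bsub>S\<^esub> g) ` (R \<times> {0..<k})" by force
  qed
qed (use assms in simp)

text \<open>Hypothesis \<open>fin\<close> gives \<open>con k\<close> finite index. Hypothesis
  \<open>sep\<close> treats elements of \<open>B\<close>, whose conjugacy classes in
  \<open>S\<close> are their orbits under \<open>T\<close>; for the other elements
  \<open>conj_S\<close> and \<open>cob_geometric\<close> provide \<open>k\<close> directly.\<close>

theorem conjugacy_separable_S:
  assumes fin: "\<And>k. k > 0 \<Longrightarrow> \<exists>R. finite R \<and> R \<subseteq> carrier B \<and>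
      (\<forall>u\<in>carrier B. \<exists>r\<in>R. u \<otimes> inv r \<in> cob k)"
    and sep: "\<And>u w. \<lbrakk>u \<in> carrier B; w \<in> carrier B; \<And>l. w \<noteq> T l u\<rbrakk> \<Longrightarrow>
      \<exists>k>0. \<forall>l. T l u \<otimes> inv w \<notin> cob k"
  shows "conjugacy_separable S"
proof (rule conjugacy_separableI[OF group_S])
  fix f g assume "f \<in> carrier S" "g \<in> carrier S" and nc: "\<not> conjugate_in S f g"
  then obtain u n w n' where fg: "f = (u, n)" "g = (w, n')" and u: "u \<in> carrier B"
    and w: "w \<in> carrier B" by (auto simp: carrier_S)
  have nc': "\<not> (\<exists>z\<in>carrier B. \<exists>l. w = z \<otimes> inv (T n z) \<otimes> T l u)" if "n = n'"
    using nc u that by (force simp: conjugate_in_def fg carrier_S conj_S)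
  \<comment> \<open>The two conditions say that both components of \<open>h f h^-1 g^-1\<close> lie
    in \<open>con k\<close>, for \<open>h = (z, l)\<close>; the translate of \<open>w\<close> comes
    from inverting \<open>g\<close>.\<close>
  have "\<exists>k>0. \<forall>z\<in>carrier B. \<forall>l. \<not> (z \<otimes> inv (T n z) \<otimes> T l u \<otimes> inv (T (n - n') w) \<in> cob k \<and> k dvd n - n')"
  proof -
    consider "n \<noteq> n'" | "n = n'" "n \<noteq> 0" | "n = n'" "n = 0" by blast
    then show ?thesis
    proof cases
      case 1
      then have "\<not> \<bar>n - n'\<bar> + 1 dvd n - n'"
        using dvd_imp_le_int[of "n - n'" "\<bar>n - n'\<bar> + 1"] by auto
      then show ?thesis by (intro exI[of _ "\<bar>n - n'\<bar> + 1"]) auto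
    next
      case 2
      have False if z: "z \<in> carrier B" and c: "z \<otimes> inv (T n z) \<otimes> T l u \<otimes> inv w \<in> cob \<bar>n\<bar>" for z l
      proof -
        let ?x = "z \<otimes> inv (T n z) \<otimes> T l u"
        from c obtain v where v: "v \<in> carrier B" "?x \<otimes> inv w = v \<otimes> inv (T \<bar>n\<bar> v)"
          by (rule cobE)
        \<comment> \<open>Since \<open>\<bar>n\<bar>\<close> is \<open>n * sgn n\<close>,
          coboundaries for \<open>\<bar>n\<bar>\<close> are coboundaries for
          \<open>n\<close>.\<close>
        have "?x \<otimes> inv w \<in> cob n"
          unfolding v(2) abs_sgn by (rule cob_geometric[OF v(1)])
        then have "w \<otimes> inv ?x \<in> cob n"
          by (rule cob_sym[rotated 2]) (use u w z in simp_all)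
        moreover have "z \<otimes> inv (T n z) \<in> cob n" using z by (rule cobI)
        \<comment> \<open>The coboundary inside \<open>?x\<close> is absorbed, so \<open>w\<close>
          and \<open>T l u\<close> differ by the coboundary of a single \<open>y\<close>. That makes
          \<open>f\<close> and \<open>g\<close> truly conjugate.\<close>
        ultimately have "w \<otimes> inv ?x \<otimes> (z \<otimes> inv (T n z)) \<in> cob n"
          by (rule subgroup.m_closed[OF subgroup_cob])
        then obtain y where y: "y \<in> carrier B"
          "w \<otimes> inv ?x \<otimes> (z \<otimes> inv (T n z)) = y \<otimes> inv (T n y)"
          by (rule cobE)
        have "w \<otimes> inv ?x \<otimes> (z \<otimes> inv (T n z)) \<otimes> T l u = w \<otimes> inv ?x \<otimes> ?x"
          using u w z by (simp add: m_assoc)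
        also have "\<dots> = w" using u w z by (simp add: m_assoc del: inv_mult_group)
        finally have "w = y \<otimes> inv (T n y) \<otimes> T l u" using y by simp
        with nc'[OF 2(1)] y(1) show False by blast
      qed
      then show ?thesis using 2 w by (intro exI[of _ "\<bar>n\<bar>"]) (auto simp: T_0)
    next
      case 3
      have "w \<noteq> T l u" for l
        using nc'[OF 3(1)] u 3 by (force simp: T_0)
      from sep[OF u w this] obtain k where "k > 0" "\<And>l. T l u \<otimes> inv w \<notin> cob k" by blast
      then show ?thesis using 3 u w by (intro exI[of _ k]) (auto simp: T_0)
    qed
  qed
  then obtain k where k: "k > 0"
    "\<And>z l. z \<in> carrier B \<Longrightarrow>
      \<not> (z \<otimes> inv (T n z) \<otimes> T l u \<otimes> inv (T (n - n') w) \<in> cob k \<and> k dvd n - n')"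
    by blast
  have "h \<otimes>\<^bsub>S\<^esub> f \<otimes>\<^bsub>S\<^esub> inv\<^bsub>S\<^esub> h \<otimes>\<^bsub>S\<^esub> inv\<^bsub>S\<^esub> g \<notin> con k" if h: "h \<in> carrier S" for h
  proof -
    obtain z l where zl: "h = (z, l)" "z \<in> carrier B" using h by (auto simp: carrier_S)
    show ?thesis
      using k(2)[OF zl(2), of l] u w
      by (simp add: fg zl conj_S) (auto simp: con_def mult_S inv_S T_T)
  qed
  moreover obtain R where "finite R" "R \<subseteq> carrier B"
      "\<And>u. u\<in>carrier B \<Longrightarrow> \<exists>r\<in>R. u \<otimes> inv r \<in> cob k" using fin[OF k(1)] by blast
  then have "finite (rcosets\<^bsub>S\<^esub> con k)" by (intro finite_rcosets_con k(1))
  ultimately show "\<exists>N. N \<lhd> S \<and> finite (rcosets\<^bsub>S\<^esub> N) \<and>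
        (\<forall>h\<in>carrier S. h \<otimes>\<^bsub>S\<^esub> f \<otimes>\<^bsub>S\<^esub> inv\<^bsub>S\<^esub> h \<otimes>\<^bsub>S\<^esub> inv\<^bsub>S\<^esub> g \<notin> N)"
    using con_normal by blast
qed

section \<open>Subgroups with nontrivial image in the integers\<close>

lemma int_action_subgroup:
  assumes "subgroup M B" and inv: "\<And>x j. x \<in> M \<Longrightarrow> T (m * j) x \<in> M"
  shows "int_action (B\<lparr>carrier := M\<rparr>) (\<lambda>j. T (m * j))"
proof -
  interpret M: subgroup M B by fact
  have mem: "x \<in> carrier B" if "x \<in> M" for x using that by (rule M.mem_carrier)
  interpret M': group "B\<lparr>carrier := M\<rparr>" by (rule M.subgroup_is_group[OF is_group])
  show ?thesis
    by unfold_locales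
      (auto simp: mem m_comm hom_def T_0 T_T distrib_left intro: inv)
qed

text \<open>For \<open>s \<in> H\<close> whose \<open>\<int>\<close>-component generates the image of \<open>H\<close>, the isomorphism is
  \<open>(x, j) \<mapsto> (x, 0) s\<^sup>j\<close>; the \<open>B\<close>-component of \<open>s\<close> does not affect its action on \<open>M\<close>.\<close>

lemma subgroup_S_iso:
  assumes H: "subgroup H S" and ex: "\<exists>h\<in>H. snd h \<noteq> 0"
  defines "M \<equiv> {x. (x, 0) \<in> H}"
  obtains m \<psi> where "m > 0" "subgroup M B" "\<And>x j. x \<in> M \<Longrightarrow> T (m * j) x \<in> M"
    "\<psi> \<in> iso (semidirect_product (B\<lparr>carrier := M\<rparr>) integer_group (\<lambda>j. T (m * j))) (S\<lparr>carrier := H\<rparr>)"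
proof -
  interpret S: group S by (rule group_S)
  interpret H: subgroup H S by fact
  have sub: "x \<in> carrier B" if "(x, n) \<in> H" for x n
    using H.mem_carrier[OF that] by (simp add: carrier_S)
  interpret snd: group_hom S integer_group snd
    unfolding group_hom_def group_hom_axioms_def
    by (auto simp: hom_def group_S carrier_S mult_S)
  have snd_mult: "snd (g \<otimes>\<^bsub>S\<^esub> h) = snd g + snd h" if "g \<in> H" "h \<in> H" for g h
    using that by simp
  have snd_inv: "snd (inv\<^bsub>S\<^esub> g) = - snd g" if "g \<in> H" for g
    using that by simp
  have snd_pow: "snd (g [^]\<^bsub>S\<^esub> j) = snd g * j" if "g \<in> H" for g and j :: int
    using that by (simp add: snd.hom_int_pow)
  have pow_closed: "g [^]\<^bsub>S\<^esub> j \<in> H" if "g \<in> H" for g and j :: int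
    using that by (rule S.subgroup_int_pow_closed[OF H])
  obtain h where h: "h \<in> H" "snd h \<noteq> 0" using ex by blast
  \<comment> \<open>The least positive integer \<open>m\<close> in the image of \<open>H\<close>
    under \<open>snd\<close> will generate that image; \<open>s\<close> is an element of
    \<open>H\<close> above it.\<close>
  define P where "P n \<longleftrightarrow> n > 0 \<and> (\<exists>g\<in>H. snd g = int n)" for n
  have "P (nat \<bar>snd h\<bar>)"
    using h H.m_inv_closed[OF h(1)] snd_inv[OF h(1)]
    unfolding P_def
    by (cases "snd h > 0") (auto intro: bexI[of _ h] bexI[of _ "inv\<^bsub>S\<^esub> h"])
  then have PL: "P (LEAST n. P n)" by (rule LeastI)
  define m where "m = int (LEAST n. P n)"
  from PL obtain s where m: "m > 0" and s: "s \<in> H" "snd s = m"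
    unfolding P_def m_def by auto
  have dvd: "snd g = m * (snd g div m)" if g: "g \<in> H" for g
  proof (rule ccontr)
    let ?r = "snd g mod m"
    assume "snd g \<noteq> m * (snd g div m)"
    then have r: "?r \<noteq> 0" by (metis add.right_neutral mult_div_mod_eq)
    have r0: "?r > 0" "?r < m" using r pos_mod_sign[OF m, of "snd g"] pos_mod_bound[OF m, of "snd g"] by linarith+
    \<comment> \<open>Division with remainder: this element of \<open>H\<close> has second component
      \<open>snd g mod m\<close>, which would be positive and smaller than \<open>m\<close>.\<close>
    let ?g = "g \<otimes>\<^bsub>S\<^esub> s [^]\<^bsub>S\<^esub> (- (snd g div m))"
    have "?g \<in> H" using g s by (intro H.m_closed pow_closed)
    moreover have "snd ?g = ?r"
      using g s by (simp add: snd_mult pow_closed snd_pow minus_mult_div_eq_mod[symmetric] del: snd.hom_mult)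
    ultimately have "P (nat ?r)" using r0 unfolding P_def by force
    then have "(LEAST n. P n) \<le> nat ?r" by (rule Least_le)
    with r0 show False unfolding m_def by linarith
  qed
  have M: "subgroup M B"
  proof (rule subgroupI)
    show "M \<subseteq> carrier B" using sub by (auto simp: M_def)
    show "M \<noteq> {}" using H.one_closed by (auto simp: M_def one_S)
  next
    fix x assume "x \<in> M"
    then show "inv x \<in> M"
      using H.m_inv_closed[of "(x, 0)"] by (simp add: M_def inv_S sub T_0)
  next
    fix x y assume "x \<in> M" "y \<in> M"
    then show "x \<otimes> y \<in> M"
      using H.m_closed[of "(x, 0)" "(y, 0)"] by (simp add: M_def mult_S sub T_0)
  qed
  \<comment> \<open>The first component of the power of \<open>s\<close> cancels, because
    \<open>conj_S\<close> is applied with \<open>n = 0\<close>.\<close>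
  have conj: "s [^]\<^bsub>S\<^esub> j \<otimes>\<^bsub>S\<^esub> (x, 0) \<otimes>\<^bsub>S\<^esub> inv\<^bsub>S\<^esub> (s [^]\<^bsub>S\<^esub> j) = (T (m * j) x, 0)"
    if "x \<in> M" for x and j :: int
  proof -
    obtain z where z: "s [^]\<^bsub>S\<^esub> j = (z, m * j)"
      using snd_pow[OF s(1), of j] s(2) by (metis prod.collapse)
    have "z \<in> carrier B" using sub pow_closed[OF s(1), of j] z by metis
    moreover have "x \<in> carrier B" using that sub by (auto simp: M_def)
    ultimately show ?thesis by (simp add: z conj_S T_0)
  qed
  have inv: "T (m * j) x \<in> M" if "x \<in> M" for x j
  proof -
    have "s [^]\<^bsub>S\<^esub> j \<otimes>\<^bsub>S\<^esub> (x, 0) \<otimes>\<^bsub>S\<^esub> inv\<^bsub>S\<^esub> (s [^]\<^bsub>S\<^esub> j) \<in> H"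
      using that pow_closed[OF s(1)] by (intro H.m_closed H.m_inv_closed) (auto simp: M_def)
    then show ?thesis using conj[OF that] by (simp add: M_def)
  qed
  let ?G = "semidirect_product (B\<lparr>carrier := M\<rparr>) integer_group (\<lambda>j. T (m * j))"
  define \<psi> where "\<psi> = (\<lambda>(x, j :: int). (x, 0) \<otimes>\<^bsub>S\<^esub> s [^]\<^bsub>S\<^esub> j)"
  have carG: "carrier ?G = M \<times> UNIV" by (simp add: semidirect_product_def)
  have x0: "(x, 0) \<in> H" if "x \<in> M" for x using that by (simp add: M_def)
  have x0S: "(x, 0) \<in> carrier S" if "x \<in> M" for x using x0[OF that] H.mem_carrier by blast
  have sS: "s \<in> carrier S" using s by simp
  have \<psi>H: "\<psi> p \<in> H" if "p \<in> carrier ?G" for p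
    using that s(1) by (auto simp: carG \<psi>_def x0 pow_closed)
  have "\<psi> \<in> hom ?G (S\<lparr>carrier := H\<rparr>)"
  proof (rule homI)
    show "\<psi> p \<in> carrier (S\<lparr>carrier := H\<rparr>)" if "p \<in> carrier ?G" for p using \<psi>H[OF that] by simp
  next
    fix p q assume "p \<in> carrier ?G" "q \<in> carrier ?G"
    then obtain x j y k where pq: "p = (x, j)" "q = (y, k)" and xy: "x \<in> M" "y \<in> M"
      by (auto simp: carG)
    let ?s = "\<lambda>j :: int. s [^]\<^bsub>S\<^esub> j"
    have "\<psi> (p \<otimes>\<^bsub>?G\<^esub> q) = (x \<otimes> T (m * j) y, 0) \<otimes>\<^bsub>S\<^esub> ?s (j + k)"
      by (simp add: pq \<psi>_def semidirect_product_def)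
    also have "(x \<otimes> T (m * j) y, 0) = (x, 0) \<otimes>\<^bsub>S\<^esub> (T (m * j) y, 0)"
      using subgroup.mem_carrier[OF M] xy by (simp add: mult_S T_0)
    \<comment> \<open>The translate of \<open>y\<close> is rewritten as a conjugate by the
      \<open>j\<close>-th power of \<open>s\<close>, so the inverse power cancels against the factor
      on its right.\<close>
    also have "\<dots> \<otimes>\<^bsub>S\<^esub> ?s (j + k) = (x, 0) \<otimes>\<^bsub>S\<^esub> (?s j \<otimes>\<^bsub>S\<^esub> (y, 0) \<otimes>\<^bsub>S\<^esub> inv\<^bsub>S\<^esub> (?s j)) \<otimes>\<^bsub>S\<^esub> (?s j \<otimes>\<^bsub>S\<^esub> ?s k)"
      unfolding conj[OF xy(2)] using sS by (simp add: S.int_pow_mult)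
    also have "\<dots> = (x, 0) \<otimes>\<^bsub>S\<^esub> ?s j \<otimes>\<^bsub>S\<^esub> ((y, 0) \<otimes>\<^bsub>S\<^esub> (inv\<^bsub>S\<^esub> (?s j) \<otimes>\<^bsub>S\<^esub> (?s j \<otimes>\<^bsub>S\<^esub> ?s k)))"
      using x0S[OF xy(1)] x0S[OF xy(2)] sS by (simp add: S.m_assoc)
    also have "inv\<^bsub>S\<^esub> (?s j) \<otimes>\<^bsub>S\<^esub> (?s j \<otimes>\<^bsub>S\<^esub> ?s k) = ?s k"
      using sS by (simp add: S.m_assoc[symmetric])
    finally show "\<psi> (p \<otimes>\<^bsub>?G\<^esub> q) = \<psi> p \<otimes>\<^bsub>S\<lparr>carrier := H\<rparr>\<^esub> \<psi> q"
      by (simp add: pq \<psi>_def)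
  qed
  moreover have snd_\<psi>: "snd (\<psi> (x, j)) = m * j" if "x \<in> M" for x j
    using that s by (simp add: \<psi>_def snd_mult x0 pow_closed snd_pow del: snd.hom_mult)
  have "inj_on \<psi> (carrier ?G)"
  proof (rule inj_onI)
    fix p q assume "p \<in> carrier ?G" "q \<in> carrier ?G" and eq: "\<psi> p = \<psi> q"
    then obtain x j y k where pq: "p = (x, j)" "q = (y, k)" and xy: "x \<in> M" "y \<in> M"
      by (auto simp: carG)
    have "m * j = m * k" using eq snd_\<psi> xy by (metis pq)
    then have jk: "j = k" using m by simp
    with eq have "(x, 0 :: int) = (y, 0)"
      using x0S[OF xy(1)] x0S[OF xy(2)] sS by (simp add: pq \<psi>_def del: prod.inject)
    with jk show "p = q" by (simp add: pq)
  qed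
  moreover have "\<psi> ` carrier ?G = H"
  proof (intro equalityI subsetI)
    fix g assume g: "g \<in> H"
    \<comment> \<open>Dividing \<open>g\<close> by the power of \<open>s\<close> with the same
      second component leaves an element of \<open>M\<close>.\<close>
    let ?j = "snd g div m"
    let ?g = "g \<otimes>\<^bsub>S\<^esub> inv\<^bsub>S\<^esub> (s [^]\<^bsub>S\<^esub> ?j)"
    have "?g \<in> H" using g s by (intro H.m_closed H.m_inv_closed pow_closed)
    moreover have "snd ?g = 0"
      using g s dvd[OF g] by (simp add: snd_mult snd_inv pow_closed snd_pow del: snd.hom_mult)
    ultimately have 1: "?g = (fst ?g, 0)" "fst ?g \<in> M" by (auto simp: M_def prod_eq_iff) (metis prod.collapse)
    have "\<psi> (fst ?g, ?j) = ?g \<otimes>\<^bsub>S\<^esub> s [^]\<^bsub>S\<^esub> ?j" unfolding \<psi>_def using 1 by simp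
    also have "\<dots> = g" using g sS by (simp add: S.m_assoc)
    finally have "g = \<psi> (fst ?g, ?j)" ..
    moreover have "(fst ?g, ?j) \<in> carrier ?G" using 1(2) by (simp add: carG)
    ultimately show "g \<in> \<psi> ` carrier ?G" by (rule image_eqI)
  qed (use \<psi>H in auto)
  ultimately have "\<psi> \<in> iso ?G (S\<lparr>carrier := H\<rparr>)"
    by (simp add: iso_def bij_betw_def)
  with m M inv that show ?thesis by blast
qed

end

section \<open>Wreath products of finite abelian groups with the integers\<close>

definition shift :: "int \<Rightarrow> (int \<Rightarrow> 'a) \<Rightarrow> int \<Rightarrow> 'a" where
  "shift k x i = x (i - k)"

abbreviation int_sum :: "('a, 'b) monoid_scheme \<Rightarrow> (int \<Rightarrow> 'a) monoid" where
  "int_sum A \<equiv> sum_group UNIV (\<lambda>_. A)"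

lemma wreath_int_eq: "wreath_int A = semidirect_product (int_sum A) integer_group shift"
  unfolding wreath_int_def shift_def[abs_def] ..

locale finite_comm_group = comm_group A for A (structure) +
  assumes fin: "finite (carrier A)"
begin

lemma carrier_int_sum:
  "x \<in> carrier (int_sum A) \<longleftrightarrow> (\<forall>i. x i \<in> carrier A) \<and> finite {i. x i \<noteq> \<one>}"
  by (auto simp: carrier_sum_group is_group PiE_def Pi_def)

lemma int_sum_mult: "x \<otimes>\<^bsub>int_sum A\<^esub> y = (\<lambda>i. x i \<otimes> y i)"
  by (simp add: fun_eq_iff)

lemma int_sum_one: "\<one>\<^bsub>int_sum A\<^esub> = (\<lambda>i. \<one>)"
  by (simp add: fun_eq_iff)

lemma int_sum_inv: "x \<in> carrier (int_sum A) \<Longrightarrow> inv\<^bsub>int_sum A\<^esub> x = (\<lambda>i. inv (x i))"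
  by (simp add: is_group fun_eq_iff)

declare mult_sum_group [simp del] one_sum_group [simp del] inv_sum_group [simp del]

lemma int_sum_closed: "x \<in> carrier (int_sum A) \<Longrightarrow> x i \<in> carrier A"
  by (simp add: carrier_int_sum)

lemma int_action_shift: "int_action (int_sum A) shift"
proof -
  interpret B: group "int_sum A" by (simp add: is_group)
  have fin: "finite {i. x (i - k) \<noteq> \<one>}" if "finite {i. x i \<noteq> \<one>}"
    for x :: "int \<Rightarrow> 'a" and k :: int
  proof -
    have "{i. x (i - k) \<noteq> \<one>} = (\<lambda>i. i + k) ` {i. x i \<noteq> \<one>}"
      by (force simp: image_iff)
    then show ?thesis using that by simp
  qed
  show ?thesis
  proof unfold_locales
    fix x y assume "x \<in> carrier (int_sum A)" "y \<in> carrier (int_sum A)"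
    then show "x \<otimes>\<^bsub>int_sum A\<^esub> y = y \<otimes>\<^bsub>int_sum A\<^esub> x"
      by (simp add: int_sum_mult m_comm int_sum_closed)
  next
    show "shift n \<in> hom (int_sum A) (int_sum A)" for n
      by (rule homI) (auto simp: carrier_int_sum shift_def int_sum_mult fin)
  qed (auto simp: shift_def algebra_simps)
qed

sublocale B: int_action "int_sum A" shift
  by (rule int_action_shift)

section \<open>Supports in the base group\<close>

definition supp :: "(int \<Rightarrow> 'a) \<Rightarrow> int set" where
  "supp x = {i. x i \<noteq> \<one>}"

lemma finite_supp: "x \<in> carrier (int_sum A) \<Longrightarrow> finite (supp x)"
  by (simp add: carrier_int_sum supp_def)

lemma supp_mult: "supp (x \<otimes>\<^bsub>int_sum A\<^esub> y) \<subseteq> supp x \<union> supp y"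
  by (auto simp: supp_def int_sum_mult)

lemma supp_inv: "x \<in> carrier (int_sum A) \<Longrightarrow> supp (inv\<^bsub>int_sum A\<^esub> x) = supp x"
  by (auto simp: supp_def int_sum_inv int_sum_closed)

lemma supp_shift: "supp (shift k x) = (\<lambda>i. i + k) ` supp x"
  by (force simp: supp_def shift_def image_iff)

lemma supp_empty: "supp x = {} \<Longrightarrow> x = \<one>\<^bsub>int_sum A\<^esub>"
  by (auto simp: supp_def int_sum_one)

lemma ex_supp_bound:
  assumes "finite X" "X \<subseteq> carrier (int_sum A)"
  shows "\<exists>n \<ge> 0. \<forall>x\<in>X. supp x \<subseteq> {-n..<n}"
proof -
  let ?U = "\<Union>x\<in>X. abs ` supp x"
  have "finite ?U" using assms by (auto intro: finite_supp)
  then have "bdd_above ?U" by simp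
  then obtain n where n: "\<And>y. y \<in> ?U \<Longrightarrow> y \<le> n" by (auto simp: bdd_above_def)
  \<comment> \<open>The added 1 accounts for the half-open window. The absolute value keeps the
    bound nonnegative even if all supports are empty and \<open>n\<close> is negative.\<close>
  have "supp x \<subseteq> {-(\<bar>n\<bar> + 1)..<\<bar>n\<bar> + 1}" if "x \<in> X" for x
    using n that by fastforce
  then show ?thesis by (intro exI[of _ "\<bar>n\<bar> + 1"]) simp
qed

lemma finite_supp_subset:
  assumes "finite I"
  shows "finite {x \<in> carrier (int_sum A). supp x \<subseteq> I}"
proof (rule finite_imageD)
  show "finite ((\<lambda>x. restrict x I) ` {x \<in> carrier (int_sum A). supp x \<subseteq> I})"
    by (rule finite_subset[OF _ finite_PiE[OF assms, of "\<lambda>_. carrier A"]])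
      (auto simp: fin int_sum_closed)
  show "inj_on (\<lambda>x. restrict x I) {x \<in> carrier (int_sum A). supp x \<subseteq> I}"
  proof (rule inj_onI, rule ext)
    fix x y i
    assume *: "x \<in> {x \<in> carrier (int_sum A). supp x \<subseteq> I}" "y \<in> {x \<in> carrier (int_sum A). supp x \<subseteq> I}"
      "restrict x I = restrict y I"
    show "x i = y i"
      using *(1,2) fun_cong[OF *(3), of i] 
      by (cases "i \<in> I") (simp_all add: supp_def subset_iff, metis)
  qed
qed

text \<open>For nontrivial \<open>v\<close> nothing cancels at \<open>Min (supp v)\<close> and at
  \<open>Max (supp v) + k\<close>, so both belong to the support of the coboundary. They are at
  least \<open>k\<close> apart, too far for a half-open window of length \<open>k\<close>.\<close>

lemma coboundary_supp:
  assumes v: "v \<in> carrier (int_sum A)" and k: "k > 0"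
    and supp: "supp (v \<otimes>\<^bsub>int_sum A\<^esub> inv\<^bsub>int_sum A\<^esub> (shift k v)) \<subseteq> {a..<a + k}"
  shows "v = \<one>\<^bsub>int_sum A\<^esub>"
proof (rule ccontr)
  assume "v \<noteq> \<one>\<^bsub>int_sum A\<^esub>"
  then have ne: "supp v \<noteq> {}" using supp_empty by blast
  have fs: "finite (supp v)" using v by (rule finite_supp)
  let ?b = "Min (supp v)" and ?t = "Max (supp v)"
  have val: "(v \<otimes>\<^bsub>int_sum A\<^esub> inv\<^bsub>int_sum A\<^esub> (shift k v)) i = v i \<otimes> inv (v (i - k))" for i
    using v by (simp add: int_sum_mult int_sum_inv shift_def)
  have "v (?b - k) = \<one>" using Min_le[OF fs, of "?b - k"] k by (force simp: supp_def)
  moreover have "v ?b \<noteq> \<one>" using Min_in[OF fs ne] by (simp add: supp_def)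
  ultimately have "?b \<in> {a..<a + k}"
    using v val[of ?b] by (intro subsetD[OF supp]) (simp add: supp_def int_sum_closed)
  moreover have "v (?t + k) = \<one>" using Max_ge[OF fs, of "?t + k"] k by (force simp: supp_def)
  moreover have "v ?t \<noteq> \<one>" using Max_in[OF fs ne] by (simp add: supp_def)
  ultimately have "?t + k \<in> {a..<a + k}"
    using v val[of "?t + k"] by (intro subsetD[OF supp]) (simp add: supp_def int_sum_closed)
  with \<open>?b \<in> {a..<a + k}\<close> Min_le[OF fs Max_in[OF fs ne]] show False by simp
qed

section \<open>Finite index of the coboundaries by counting\<close>

text \<open>Two injections give the bound. Adding coboundaries of \<open>D\<close> to
  \<open>R\<close> embeds \<open>R \<times> D\<close> into \<open>E\<close>; recording the top
  \<open>k\<close> coordinates and the remaining part embeds \<open>E\<close> into a product of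
  \<open>D\<close> with \<open>k\<close> copies of \<open>A\<close>. Then \<open>card D\<close>
  cancels.\<close>

lemma card_independent_le:
  assumes M: "subgroup M (int_sum A)" and inv: "\<And>x. x \<in> M \<Longrightarrow> shift k x \<in> M" and k: "k > 0"
    and R: "finite R" "R \<subseteq> M"
    and indep: "\<And>r r' v. \<lbrakk>r \<in> R; r' \<in> R; v \<in> M;
        r \<otimes>\<^bsub>int_sum A\<^esub> inv\<^bsub>int_sum A\<^esub> r' = v \<otimes>\<^bsub>int_sum A\<^esub> inv\<^bsub>int_sum A\<^esub> (shift k v)\<rbrakk> \<Longrightarrow> r = r'"
  shows "card R \<le> card (carrier A) ^ nat k"
proof -
  let ?B = "int_sum A"
  interpret M: subgroup M ?B by fact
  have RB: "R \<subseteq> carrier ?B" using R M.subset by blast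
  obtain n where n: "n \<ge> 0" "\<And>x. x \<in> R \<Longrightarrow> supp x \<subseteq> {-n..<n}"
    using ex_supp_bound[OF R(1) RB] by blast
  define D where "D = {x \<in> M. supp x \<subseteq> {-n..<n}}"
  define E where "E = {x \<in> M. supp x \<subseteq> {-n..<n + k}}"
  let ?d = "\<lambda>v. v \<otimes>\<^bsub>?B\<^esub> inv\<^bsub>?B\<^esub> (shift k v)"
  have finD: "finite D" unfolding D_def
    by (rule finite_subset[OF _ finite_supp_subset[of "{-n..<n}"]]) auto
  have finE: "finite E" unfolding E_def
    by (rule finite_subset[OF _ finite_supp_subset[of "{-n..<n + k}"]]) auto
  have "\<one>\<^bsub>?B\<^esub> \<in> D" using M.one_closed by (simp add: D_def supp_def int_sum_one)
  then have D0: "card D > 0" using finD by (auto simp: card_gt_0_iff)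
  have dM: "?d v \<in> M" if "v \<in> M" for v using that inv by blast
  have mult_d: "?d v \<otimes>\<^bsub>?B\<^esub> inv\<^bsub>?B\<^esub> ?d w = ?d (v \<otimes>\<^bsub>?B\<^esub> inv\<^bsub>?B\<^esub> w)"
    if "v \<in> carrier ?B" "w \<in> carrier ?B" for v w
    using that by (simp add: B.m_ac B.inv_mult)
  have "card R * card D = card (R \<times> D)" by (simp add: card_cartesian_product)
  also have "\<dots> \<le> card E"
  proof (rule card_inj_on_le[OF _ _ finE])
    let ?f = "\<lambda>(r, v). r \<otimes>\<^bsub>?B\<^esub> ?d v"
    show "?f ` (R \<times> D) \<subseteq> E"
    proof clarify
      fix r v assume r: "r \<in> R" and v: "v \<in> D"
      have vB: "v \<in> carrier ?B" using v by (auto simp: D_def)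
      have "r \<otimes>\<^bsub>?B\<^esub> ?d v \<in> M" using r v R dM by (auto simp: D_def)
      moreover have "supp (r \<otimes>\<^bsub>?B\<^esub> ?d v) \<subseteq> supp r \<union> (supp v \<union> supp (shift k v))"
        using supp_mult[of r "?d v"] supp_mult[of v "inv\<^bsub>?B\<^esub> (shift k v)"] vB
        by (auto simp: supp_inv)
      moreover have "\<dots> \<subseteq> {-n..<n + k}"
        using n(2)[OF r] v k by (fastforce simp: D_def supp_shift)
      ultimately show "r \<otimes>\<^bsub>?B\<^esub> ?d v \<in> E" by (auto simp: E_def)
    qed
    show "inj_on ?f (R \<times> D)"
    proof (rule inj_onI, clarify)
      fix r v r' v' assume r: "r \<in> R" "r' \<in> R" and v: "v \<in> D" "v' \<in> D"
        and eq: "r \<otimes>\<^bsub>?B\<^esub> ?d v = r' \<otimes>\<^bsub>?B\<^esub> ?d v'"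
      have vM: "v \<in> M" "v' \<in> M" using v by (auto simp: D_def)
      have B: "r \<in> carrier ?B" "r' \<in> carrier ?B" "v \<in> carrier ?B" "v' \<in> carrier ?B"
        using r vM RB by auto
      have dB: "?d v \<in> carrier ?B" "?d v' \<in> carrier ?B" using B by auto
      have "r \<otimes>\<^bsub>?B\<^esub> inv\<^bsub>?B\<^esub> r' = ?d v' \<otimes>\<^bsub>?B\<^esub> inv\<^bsub>?B\<^esub> ?d v"
      proof -
        have "r = r' \<otimes>\<^bsub>?B\<^esub> ?d v' \<otimes>\<^bsub>?B\<^esub> inv\<^bsub>?B\<^esub> ?d v"
          unfolding eq[symmetric] using B dB by (simp only: B.m_assoc B.r_inv B.r_one B.inv_closed)
        also have "\<dots> = (?d v' \<otimes>\<^bsub>?B\<^esub> inv\<^bsub>?B\<^esub> ?d v) \<otimes>\<^bsub>?B\<^esub> r'"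
          using B dB by (simp only: B.m_ac B.m_closed B.inv_closed)
        finally show ?thesis
          using B dB by (metis B.inv_solve_right B.m_closed B.inv_closed)
      qed
      also have "\<dots> = ?d (v' \<otimes>\<^bsub>?B\<^esub> inv\<^bsub>?B\<^esub> v)" by (rule mult_d[OF B(4,3)])
      finally have rr: "r = r'" using indep[OF r] vM by blast
      with eq have "?d v = ?d v'" using B dB by (simp add: B.Units_eq)
      then have "?d (v \<otimes>\<^bsub>?B\<^esub> inv\<^bsub>?B\<^esub> v') = \<one>\<^bsub>?B\<^esub>"
        unfolding mult_d[OF B(3,4), symmetric] using dB by (metis B.r_inv)
      \<comment> \<open>An empty support fits into any window of length \<open>k\<close>, so
        \<open>coboundary_supp\<close> shows that \<open>1 - shift k\<close> is injective.\<close>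
      then have "supp (?d (v \<otimes>\<^bsub>?B\<^esub> inv\<^bsub>?B\<^esub> v')) \<subseteq> {0..<0 + k}"
        by (simp add: supp_def int_sum_one)
      then have "v \<otimes>\<^bsub>?B\<^esub> inv\<^bsub>?B\<^esub> v' = \<one>\<^bsub>?B\<^esub>"
        by (rule coboundary_supp[rotated 2]) (use B k in simp_all)
      then have "v = v'" using B by (metis B.inv_equality B.inv_inv B.inv_closed)
      with rr show "r = r' \<and> v = v'" by simp
    qed
  qed
  also have "card E \<le> card ((\<Pi>\<^sub>E i\<in>{n..<n + k}. carrier A) \<times> D)"
  proof -
    define top where "top x = restrict x {n..<n + k}" for x :: "int \<Rightarrow> 'a"
    \<comment> \<open>Truncating \<open>x\<close> may lead out of \<open>M\<close>. Instead
      \<open>x\<close> is compared with a fixed element of \<open>E\<close> that has the same top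
      coordinates; the quotient is trivial there and hence lies in \<open>D\<close>.\<close>
    define rep where "rep t = (SOME x. x \<in> E \<and> top x = t)" for t
    have rep: "rep (top x) \<in> E \<and> top (rep (top x)) = top x" if "x \<in> E" for x
      unfolding rep_def using that by (rule_tac someI[where x = x]) simp
    have EB: "x \<in> carrier ?B" if "x \<in> E" for x using that by (auto simp: E_def)
    let ?f = "\<lambda>x. (top x, x \<otimes>\<^bsub>?B\<^esub> inv\<^bsub>?B\<^esub> (rep (top x)))"
    show ?thesis
    proof (rule card_inj_on_le[of ?f])
      show "inj_on ?f E"
      proof (rule inj_onI)
        fix x y assume x: "x \<in> E" and y: "y \<in> E" and "?f x = ?f y"
        then have "x \<otimes>\<^bsub>?B\<^esub> inv\<^bsub>?B\<^esub> (rep (top x)) = y \<otimes>\<^bsub>?B\<^esub> inv\<^bsub>?B\<^esub> (rep (top x))"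
          by (metis prod.inject)
        then show "x = y"
          using EB[OF x] EB[OF y] EB[OF conjunct1[OF rep[OF x]]] by simp
      qed
      show "?f ` E \<subseteq> (\<Pi>\<^sub>E i\<in>{n..<n + k}. carrier A) \<times> D"
      proof (rule image_subsetI, rule SigmaI)
        fix x assume x: "x \<in> E"
        let ?r = "rep (top x)"
        have r: "?r \<in> E" "top ?r = top x" using rep[OF x] by auto
        show "top x \<in> (\<Pi>\<^sub>E i\<in>{n..<n + k}. carrier A)"
          using EB[OF x] by (auto simp: top_def int_sum_closed)
        have "(x \<otimes>\<^bsub>?B\<^esub> inv\<^bsub>?B\<^esub> ?r) i = \<one>" if "i \<in> {n..<n + k}" for i
        proof -
          have "x i = ?r i" using fun_cong[OF r(2), of i] that by (simp add: top_def)
          then show ?thesis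
            using EB[OF x] EB[OF r(1)] by (simp add: int_sum_mult int_sum_inv int_sum_closed)
        qed
        then have "supp (x \<otimes>\<^bsub>?B\<^esub> inv\<^bsub>?B\<^esub> ?r) \<inter> {n..<n + k} = {}" by (auto simp: supp_def)
        moreover have "supp (x \<otimes>\<^bsub>?B\<^esub> inv\<^bsub>?B\<^esub> ?r) \<subseteq> {-n..<n + k}"
          using supp_mult[of x "inv\<^bsub>?B\<^esub> ?r"] supp_inv[OF EB[OF r(1)]] x r(1) by (auto simp: E_def)
        ultimately have "supp (x \<otimes>\<^bsub>?B\<^esub> inv\<^bsub>?B\<^esub> ?r) \<subseteq> {-n..<n}" by fastforce
        then show "x \<otimes>\<^bsub>?B\<^esub> inv\<^bsub>?B\<^esub> ?r \<in> D" using x r(1) by (auto simp: D_def E_def)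
      qed
      show "finite ((\<Pi>\<^sub>E i\<in>{n..<n + k}. carrier A) \<times> D)"
        by (intro finite_cartesian_product finite_PiE finD) (auto simp: fin)
    qed
  qed
  also have "\<dots> = card (carrier A) ^ nat k * card D"
    by (simp add: card_cartesian_product card_PiE)
  finally show ?thesis using D0 by simp
qed

text \<open>By \<open>card_independent_le\<close> the sets of pairwise incongruent elements have
  bounded size; one of maximal size meets every class.\<close>

lemma ex_finite_transversal:
  assumes M: "subgroup M (int_sum A)" and inv: "\<And>x. x \<in> M \<Longrightarrow> shift k x \<in> M" and k: "k > 0"
  obtains R where "finite R" "R \<subseteq> M"
    "\<And>u. u \<in> M \<Longrightarrow> \<exists>r\<in>R. \<exists>v\<in>M. u \<otimes>\<^bsub>int_sum A\<^esub> inv\<^bsub>int_sum A\<^esub> r = v \<otimes>\<^bsub>int_sum A\<^esub> inv\<^bsub>int_sum A\<^esub> (shift k v)"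
proof -
  let ?B = "int_sum A"
  interpret M: subgroup M ?B by fact
  define rel where "rel u r \<longleftrightarrow> (\<exists>v\<in>M. u \<otimes>\<^bsub>?B\<^esub> inv\<^bsub>?B\<^esub> r = v \<otimes>\<^bsub>?B\<^esub> inv\<^bsub>?B\<^esub> (shift k v))" for u r
  have rel_sym: "rel r u" if rel: "rel u r" and ur: "u \<in> M" "r \<in> M" for u r
  proof -
    obtain v where v: "v \<in> M" "u \<otimes>\<^bsub>?B\<^esub> inv\<^bsub>?B\<^esub> r = v \<otimes>\<^bsub>?B\<^esub> inv\<^bsub>?B\<^esub> (shift k v)"
      using rel by (auto simp: rel_def)
    have "r \<otimes>\<^bsub>?B\<^esub> inv\<^bsub>?B\<^esub> u = inv\<^bsub>?B\<^esub> (u \<otimes>\<^bsub>?B\<^esub> inv\<^bsub>?B\<^esub> r)"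
      using ur by (simp add: B.inv_mult B.m_comm)
    also have "\<dots> = inv\<^bsub>?B\<^esub> v \<otimes>\<^bsub>?B\<^esub> inv\<^bsub>?B\<^esub> (shift k (inv\<^bsub>?B\<^esub> v))"
      unfolding v(2) using v(1) by (simp add: B.inv_mult B.m_comm)
    finally show ?thesis using v(1) unfolding rel_def by blast
  qed
  define indep where "indep R \<longleftrightarrow> finite R \<and> R \<subseteq> M \<and> (\<forall>r\<in>R. \<forall>r'\<in>R. rel r r' \<longrightarrow> r = r')" for R
  have bound: "card R \<le> card (carrier A) ^ nat k" if R: "indep R" for R
  proof (rule card_independent_le[OF M inv k])
    show "finite R" "R \<subseteq> M" using R by (auto simp: indep_def)
  next
    fix r r' v assume "r \<in> R" "r' \<in> R" "v \<in> M"
      "r \<otimes>\<^bsub>?B\<^esub> inv\<^bsub>?B\<^esub> r' = v \<otimes>\<^bsub>?B\<^esub> inv\<^bsub>?B\<^esub> (shift k v)"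
    then show "r = r'" using R unfolding indep_def rel_def by blast
  qed
  have "indep {}" by (simp add: indep_def)
  then obtain R where R: "indep R" and max: "\<And>R'. indep R' \<Longrightarrow> card R' \<le> card R"
    using ex_has_greatest_nat[of indep "{}" card "card (carrier A) ^ nat k + 1"] bound
    by (metis less_Suc_eq_le Suc_eq_plus1)
  have fin: "finite R" and RM: "R \<subseteq> M" using R by (auto simp: indep_def)
  have "\<exists>r\<in>R. rel u r" if u: "u \<in> M" for u
  proof (rule ccontr)
    assume no: "\<not> (\<exists>r\<in>R. rel u r)"
    have "rel u u"
      unfolding rel_def using u M.one_closed by (intro bexI[of _ "\<one>\<^bsub>?B\<^esub>"]) auto
    with no have "u \<notin> R" by blast
    \<comment> \<open>Independence concerns both orders of a pair; \<open>rel_sym\<close> reduces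
      the second to the first.\<close>
    moreover have "indep (insert u R)"
      using R u no rel_sym unfolding indep_def by blast
    ultimately show False using max[of "insert u R"] fin by simp
  qed
  with fin RM that show ?thesis unfolding rel_def by blast
qed

section \<open>Separating elements of the base group\<close>

text \<open>Modulo \<open>cob (m * k)\<close> only the residue of \<open>l\<close> modulo
  \<open>k\<close> matters. For large \<open>k\<close> a residue near 0 puts \<open>w\<close> and
  the translate of \<open>u\<close> into a common window of length \<open>m * k\<close>, where
  \<open>coboundary_supp\<close> turns congruence into equality.\<close>

lemma ex_separating_period:
  assumes m: "m > 0" and u: "u \<in> carrier (int_sum A)" and w: "w \<in> carrier (int_sum A)"
    and ne: "\<And>l. w \<noteq> shift (m * l) u"
  shows "\<exists>k>0. \<forall>l. shift (m * l) u \<otimes>\<^bsub>int_sum A\<^esub> inv\<^bsub>int_sum A\<^esub> w \<notin> B.cob (m * k)"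
proof -
  let ?B = "int_sum A"
  obtain n where n: "n \<ge> 0" "supp u \<subseteq> {-n..<n}" "supp w \<subseteq> {-n..<n}"
    using ex_supp_bound[of "{u, w}"] u w by auto
  \<comment> \<open>The supports have width at most \<open>2 * n\<close>, less than
    \<open>m * c\<close>, and the offset of the translate is at most \<open>m * c\<close>, so a
    window of length \<open>2 * (m * c)\<close> holds both. The added 1 ensures
    \<open>c > 0\<close>.\<close>
  define c where "c = 2 * n + 1"
  have c: "c > 0" using n(1) by (simp add: c_def)
  have mc: "m * c \<ge> c" using m c mult_right_mono[of 1 m c] by simp
  have False if "shift (m * l) u \<otimes>\<^bsub>?B\<^esub> inv\<^bsub>?B\<^esub> w \<in> B.cob (m * (2 * c))" for l
  proof -
    \<comment> \<open>The representative of \<open>l\<close> modulo \<open>2 * c\<close> that lies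
      between \<open>- c\<close> and \<open>c\<close>.\<close>
    let ?l = "(l + c) mod (2 * c) - c" and ?q = "(l + c) div (2 * c)" and ?K = "m * (2 * c)"
    have l: "l = 2 * c * ?q + ?l"
      using mult_div_mod_eq[of "2 * c" "l + c"] by linarith
    have lb: "- c \<le> ?l" "?l < c"
      using c pos_mod_sign[of "2 * c" "l + c"] pos_mod_bound[of "2 * c" "l + c"] by linarith+
    let ?L = "m * ?l"
    have L: "- (m * c) \<le> ?L" "?L < m * c"
      using lb m mult_left_mono[OF lb(1), of m] mult_strict_left_mono[OF lb(2) m] by simp_all
    have "m * l = ?K * ?q + ?L" by (subst l) (simp add: algebra_simps)
    then have "shift (m * l) u = shift (?K * ?q) (shift ?L u)"
      using u by (simp add: B.T_T)
    then have "shift ?L u \<otimes>\<^bsub>?B\<^esub> inv\<^bsub>?B\<^esub> shift (m * l) u \<in> B.cob ?K"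
      using B.cob_geometric[of "shift ?L u" ?K ?q] u by simp
    then have "shift ?L u \<otimes>\<^bsub>?B\<^esub> inv\<^bsub>?B\<^esub> w \<in> B.cob ?K"
      using that u w by (intro B.cob_trans[of "shift ?L u" "shift (m * l) u" w]) simp_all
    then obtain v where v: "v \<in> carrier ?B"
      "shift ?L u \<otimes>\<^bsub>?B\<^esub> inv\<^bsub>?B\<^esub> w = v \<otimes>\<^bsub>?B\<^esub> inv\<^bsub>?B\<^esub> (shift ?K v)"
      by (rule B.cobE)
    let ?a = "min 0 ?L - n"
    have "supp (shift ?L u \<otimes>\<^bsub>?B\<^esub> inv\<^bsub>?B\<^esub> w) \<subseteq> supp (shift ?L u) \<union> supp w"
      using supp_mult[of "shift ?L u" "inv\<^bsub>?B\<^esub> w"] supp_inv[OF w] by simp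
    also have "\<dots> \<subseteq> {?a..<?a + ?K}"
    proof -
      have window: "i + L \<in> {min 0 L - n..<min 0 L - n + 2 * C} \<and> i \<in> {min 0 L - n..<min 0 L - n + 2 * C}"
        if "i \<in> {-n..<n}" "- C \<le> L" "L < C" "2 * n + 1 \<le> C" for i L C :: int
        using that by auto
      have "i + ?L \<in> {?a..<?a + ?K} \<and> i \<in> {?a..<?a + ?K}" if "i \<in> {-n..<n}" for i
        using window[OF that L] mc by (simp add: c_def mult.left_commute)
      then show ?thesis using n(2,3) by (auto simp: supp_shift)
    qed
    finally have "v = \<one>\<^bsub>?B\<^esub>"
      using v m c by (intro coboundary_supp[of v ?K]) auto
    then have "shift ?L u \<otimes>\<^bsub>?B\<^esub> inv\<^bsub>?B\<^esub> w = \<one>\<^bsub>?B\<^esub>"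
      using v(2) by simp
    then have "w = shift ?L u"
      using u w by (metis B.inv_equality B.inv_inv B.inv_closed B.T_closed)
    with ne show False by blast
  qed
  then show ?thesis using c by (intro exI[of _ "2 * c"]) auto
qed

section \<open>Finitely generated subgroups and their finite-index subgroups\<close>

text \<open>\<open>subgroup_S_iso\<close> replaces \<open>H\<close> by a semidirect product over
  \<open>M\<close>, to which \<open>conjugacy_separable_S\<close> applies. Finiteness is counted
  within \<open>M\<close>; separation is inherited from the whole base group.\<close>

lemma conjugacy_separable_subgroup:
  assumes H: "subgroup H (wreath_int A)" and ex: "\<exists>h\<in>H. snd h \<noteq> 0"
  shows "conjugacy_separable ((wreath_int A)\<lparr>carrier := H\<rparr>)"
proof -
  let ?B = "int_sum A"
  have H': "subgroup H B.S" using H by (simp add: wreath_int_eq)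
  define M where "M = {x. (x, 0) \<in> H}"
  obtain m \<psi> where m: "m > 0" and M: "subgroup M ?B"
    and inv: "\<And>x j. x \<in> M \<Longrightarrow> shift (m * j) x \<in> M"
    and \<psi>: "\<psi> \<in> iso (semidirect_product (?B\<lparr>carrier := M\<rparr>) integer_group (\<lambda>j. shift (m * j)))
        (B.S\<lparr>carrier := H\<rparr>)"
    using B.subgroup_S_iso[OF H' ex] unfolding M_def by blast
  interpret M: subgroup M ?B by fact
  interpret M': int_action "?B\<lparr>carrier := M\<rparr>" "\<lambda>j. shift (m * j)"
    by (rule B.int_action_subgroup[OF M inv])
  have inv_M: "inv\<^bsub>?B\<lparr>carrier := M\<rparr>\<^esub> x = inv\<^bsub>?B\<^esub> x" if "x \<in> M" for x
    using B.m_inv_consistent[OF M that] .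
  have cob: "M'.cob k = (\<lambda>v. v \<otimes>\<^bsub>?B\<^esub> inv\<^bsub>?B\<^esub> (shift (m * k) v)) ` M" for k
    unfolding M'.cob_def by (rule image_cong) (auto simp: inv_M inv)
  have "conjugacy_separable M'.S"
  proof (rule M'.conjugacy_separable_S)
    fix k :: int assume "k > 0"
    then have "m * k > 0" using m by simp
    then obtain R where R: "finite R" "R \<subseteq> M"
      "\<And>u. u \<in> M \<Longrightarrow> \<exists>r\<in>R. \<exists>v\<in>M. u \<otimes>\<^bsub>?B\<^esub> inv\<^bsub>?B\<^esub> r = v \<otimes>\<^bsub>?B\<^esub> inv\<^bsub>?B\<^esub> (shift (m * k) v)"
      using ex_finite_transversal[OF M inv] by blast
    have "\<exists>r\<in>R. u \<otimes>\<^bsub>?B\<lparr>carrier := M\<rparr>\<^esub> inv\<^bsub>?B\<lparr>carrier := M\<rparr>\<^esub> r \<in> M'.cob k" if u: "u \<in> M" for u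
    proof -
      obtain r v where r: "r \<in> R" and v: "v \<in> M"
        "u \<otimes>\<^bsub>?B\<^esub> inv\<^bsub>?B\<^esub> r = v \<otimes>\<^bsub>?B\<^esub> inv\<^bsub>?B\<^esub> (shift (m * k) v)"
        using R(3)[OF u] by blast
      have "u \<otimes>\<^bsub>?B\<^esub> inv\<^bsub>?B\<lparr>carrier := M\<rparr>\<^esub> r \<in> M'.cob k"
        unfolding cob inv_M[OF subsetD[OF R(2) r]] v(2) using v(1) by (rule imageI)
      with r show ?thesis by auto
    qed
    then show "\<exists>R. finite R \<and> R \<subseteq> carrier (?B\<lparr>carrier := M\<rparr>) \<and>
      (\<forall>u\<in>carrier (?B\<lparr>carrier := M\<rparr>). \<exists>r\<in>R. u \<otimes>\<^bsub>?B\<lparr>carrier := M\<rparr>\<^esub> inv\<^bsub>?B\<lparr>carrier := M\<rparr>\<^esub> r \<in> M'.cob k)"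
      using R(1,2) by (intro exI[of _ R]) simp
  next
    fix u w assume "u \<in> carrier (?B\<lparr>carrier := M\<rparr>)" "w \<in> carrier (?B\<lparr>carrier := M\<rparr>)"
      and ne: "\<And>l. w \<noteq> shift (m * l) u"
    then have uw: "u \<in> M" "w \<in> M" by auto
    obtain k where k: "k > 0"
      "\<And>l. shift (m * l) u \<otimes>\<^bsub>?B\<^esub> inv\<^bsub>?B\<^esub> w \<notin> B.cob (m * k)"
      using ex_separating_period[OF m M.mem_carrier[OF uw(1)] M.mem_carrier[OF uw(2)] ne] by blast
    \<comment> \<open>Coboundaries of \<open>M\<close> are coboundaries of the base group, so
      non-membership passes down to \<open>M\<close>.\<close>
    have "M'.cob k \<subseteq> B.cob (m * k)" unfolding cob B.cob_def using M.subset by blast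
    with k show "\<exists>k>0. \<forall>l. shift (m * l) u \<otimes>\<^bsub>?B\<lparr>carrier := M\<rparr>\<^esub> inv\<^bsub>?B\<lparr>carrier := M\<rparr>\<^esub> w \<notin> M'.cob k"
      by (intro exI[of _ k]) (auto simp: inv_M[OF uw(2)])
  qed
  moreover have "group (B.S\<lparr>carrier := H\<rparr>)"
    using subgroup.subgroup_is_group[OF H' B.group_S] .
  moreover have "inv_into (carrier M'.S) \<psi> \<in> iso (B.S\<lparr>carrier := H\<rparr>) M'.S"
    using group.iso_set_sym[OF M'.group_S \<psi>] .
  ultimately show ?thesis
    unfolding wreath_int_eq by (metis conjugacy_separable_iso M'.group_S)
qed

text \<open>The generators lie in the finite subgroup of base elements supported in the union
  \<open>I\<close> of their supports.\<close>

lemma finite_generate: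
  assumes S: "finite S" "S \<subseteq> carrier (wreath_int A)" and 0: "\<And>h. h \<in> S \<Longrightarrow> snd h = 0"
  shows "finite (generate (wreath_int A) S)"
proof -
  let ?B = "int_sum A"
  interpret W: group "wreath_int A" by (rule group_wreath_int[OF is_group])
  define I where "I = (\<Union>h\<in>S. supp (fst h))"
  have SB: "fst h \<in> carrier ?B" if "h \<in> S" for h
    using S(2) that by (auto simp: wreath_int_eq B.carrier_S)
  have "finite I" unfolding I_def using S(1) SB by (auto intro: finite_supp)
  define F where "F = {x \<in> carrier ?B. supp x \<subseteq> I} \<times> {0 :: int}"
  have "subgroup F (wreath_int A)"
  proof (rule W.subgroupI)
    show "F \<subseteq> carrier (wreath_int A)" by (auto simp: F_def wreath_int_eq B.carrier_S)
    have "(\<one>\<^bsub>?B\<^esub>, 0) \<in> F" by (simp add: F_def) (simp add: supp_def int_sum_one)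
    then show "F \<noteq> {}" by blast
  next
    fix g assume "g \<in> F"
    then show "inv\<^bsub>wreath_int A\<^esub> g \<in> F"
      by (auto simp: F_def wreath_int_eq B.inv_S B.T_0 supp_inv)
  next
    fix g h assume "g \<in> F" "h \<in> F"
    moreover from this have "supp (fst g \<otimes>\<^bsub>?B\<^esub> fst h) \<subseteq> I"
      using supp_mult[of "fst g" "fst h"] unfolding F_def by fastforce
    ultimately show "g \<otimes>\<^bsub>wreath_int A\<^esub> h \<in> F"
      by (auto simp: F_def wreath_int_eq B.mult_S B.T_0)
  qed
  moreover have "S \<subseteq> F"
    using SB 0 unfolding F_def I_def by (auto simp: mem_Times_iff)
  ultimately have "generate (wreath_int A) S \<subseteq> F" by (rule W.generate_subgroup_incl[rotated])
  moreover have "finite F" unfolding F_def by (simp add: finite_supp_subset \<open>finite I\<close>)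
  ultimately show ?thesis by (rule finite_subset)
qed

text \<open>By the pigeonhole principle two distinct powers of \<open>h\<close> lie in one coset of
  \<open>K\<close>; their quotient is in \<open>K\<close> and has second component a nonzero
  multiple of \<open>snd h\<close>.\<close>

lemma ex_snd_nonzero_finite_index:
  assumes H: "subgroup H (wreath_int A)" and K: "subgroup K ((wreath_int A)\<lparr>carrier := H\<rparr>)"
    and fin: "finite (rcosets\<^bsub>(wreath_int A)\<lparr>carrier := H\<rparr>\<^esub> K)" and h: "h \<in> H" "snd h \<noteq> 0"
  shows "\<exists>g\<in>K. snd g \<noteq> 0"
proof -
  let ?W = "wreath_int A"
  let ?H = "?W\<lparr>carrier := H\<rparr>"
  interpret W: group ?W by (rule group_wreath_int[OF is_group])
  interpret H: subgroup H ?W by fact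
  interpret H': group ?H by (rule H.subgroup_is_group[OF W.is_group])
  interpret K: subgroup K ?H by fact
  have snd_mult: "snd (a \<otimes>\<^bsub>?W\<^esub> b) = snd a + snd b" for a b
    by (cases a; cases b) (simp add: wreath_int_eq B.mult_S)
  have snd_pow: "snd (h [^]\<^bsub>?H\<^esub> (n :: nat)) = int n * snd h" for n
    by (induction n) (simp_all add: snd_mult algebra_simps, simp add: wreath_int_eq B.one_S)
  have "\<not> inj (\<lambda>n :: nat. K #>\<^bsub>?H\<^esub> (h [^]\<^bsub>?H\<^esub> n))"
  proof
    assume "inj (\<lambda>n :: nat. K #>\<^bsub>?H\<^esub> (h [^]\<^bsub>?H\<^esub> n))"
    moreover have "range (\<lambda>n :: nat. K #>\<^bsub>?H\<^esub> (h [^]\<^bsub>?H\<^esub> n)) \<subseteq> rcosets\<^bsub>?H\<^esub> K"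
      using H'.nat_pow_closed[of h] h(1) by (auto simp: RCOSETS_def)
    ultimately show False using fin finite_subset finite_imageD infinite_UNIV_nat by blast
  qed
  then obtain i j :: nat where ij: "i \<noteq> j" "K #>\<^bsub>?H\<^esub> (h [^]\<^bsub>?H\<^esub> i) = K #>\<^bsub>?H\<^esub> (h [^]\<^bsub>?H\<^esub> j)"
    by (auto simp: inj_def)
  have "h [^]\<^bsub>?H\<^esub> i \<in> K #>\<^bsub>?H\<^esub> (h [^]\<^bsub>?H\<^esub> j)"
    unfolding ij(2)[symmetric] using h(1) H'.nat_pow_closed[of h i]
    by (intro H'.rcos_self K.subgroup_axioms) simp_all
  then obtain g where g: "g \<in> K" "h [^]\<^bsub>?H\<^esub> i = g \<otimes>\<^bsub>?W\<^esub> h [^]\<^bsub>?H\<^esub> j"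
    by (auto simp: r_coset_def)
  then have "int i * snd h = snd g + int j * snd h"
    by (metis snd_mult snd_pow)
  with ij(1) h(2) have "snd g \<noteq> 0" by auto
  with g(1) show ?thesis by blast
qed

text \<open>If some generator has nonzero second component,
  \<open>conjugacy_separable_subgroup\<close> applies to \<open>H\<close> and, directly as a
  subgroup of the wreath product, to each \<open>K\<close> of finite index. Otherwise
  \<open>H\<close> and all its subgroups are finite.\<close>

theorem hereditarily_conjugacy_separable_fg_subgroup:
  assumes "finitely_generated_subgroup H (wreath_int A)"
  shows "hereditarily_conjugacy_separable ((wreath_int A)\<lparr>carrier := H\<rparr>)"
proof -
  let ?W = "wreath_int A"
  interpret W: group ?W by (rule group_wreath_int[OF is_group])
  obtain S where S: "finite S" "S \<subseteq> carrier ?W" "H = generate ?W S"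
    using assms by (auto simp: finitely_generated_subgroup_def)
  have H: "subgroup H ?W" unfolding S(3) by (rule W.generate_is_subgroup[OF S(2)])
  have SH: "S \<subseteq> H" unfolding S(3) by (auto intro: generate.incl)
  show ?thesis
  proof (cases "\<exists>h\<in>S. snd h \<noteq> 0")
    case True
    then obtain h where h: "h \<in> H" "snd h \<noteq> 0" using SH by blast
    have "conjugacy_separable (?W\<lparr>carrier := H\<rparr>\<lparr>carrier := K\<rparr>)"
      if K: "subgroup K (?W\<lparr>carrier := H\<rparr>)" "finite (rcosets\<^bsub>?W\<lparr>carrier := H\<rparr>\<^esub> K)" for K
      using conjugacy_separable_subgroup[OF W.incl_subgroup[OF H K(1)]]
        ex_snd_nonzero_finite_index[OF H K h] by simp
    moreover have "conjugacy_separable (?W\<lparr>carrier := H\<rparr>)"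
      using conjugacy_separable_subgroup[OF H] h by blast
    ultimately show ?thesis unfolding hereditarily_conjugacy_separable_def by blast
  next
    case False
    then have fin: "finite H" unfolding S(3) using finite_generate[OF S(1,2)] by blast
    have gH: "group (?W\<lparr>carrier := H\<rparr>)" by (rule subgroup.subgroup_is_group[OF H W.is_group])
    have "conjugacy_separable (?W\<lparr>carrier := H\<rparr>\<lparr>carrier := K\<rparr>)"
      if K: "subgroup K (?W\<lparr>carrier := H\<rparr>)" for K
    proof (rule conjugacy_separable_finite)
      show "group (?W\<lparr>carrier := H\<rparr>\<lparr>carrier := K\<rparr>)"
        by (rule subgroup.subgroup_is_group[OF K gH])
      show "finite (carrier (?W\<lparr>carrier := H\<rparr>\<lparr>carrier := K\<rparr>))"
        using subgroup.subset[OF K] fin by (auto intro: finite_subset)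
    qed
    moreover have "conjugacy_separable (?W\<lparr>carrier := H\<rparr>)"
      using conjugacy_separable_finite[OF gH] fin by simp
    ultimately show ?thesis unfolding hereditarily_conjugacy_separable_def by blast
  qed
qed

end

theorem corollary1p2:
  shows "(\<forall>(A :: ('a, 'b) monoid_scheme) H.
            semisimple_group A \<and> finitely_generated_subgroup H (wreath_int A) \<longrightarrow>
            hereditarily_conjugacy_separable ((wreath_int A)\<lparr>carrier := H\<rparr>)) \<and>
         (\<forall>(p :: nat) H.
            Factorial_Ring.prime p \<and>
            finitely_generated_subgroup H (wreath_int (add_monoid (residue_ring (int p)))) \<longrightarrow>
            hereditarily_conjugacy_separable
              ((wreath_int (add_monoid (residue_ring (int p))))\<lparr>carrier := H\<rparr>))"
proof (intro conjI allI impI; elim conjE)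
  fix A :: "('a, 'b) monoid_scheme" and H
  assume "semisimple_group A"
  then have "finite_comm_group A"
    by (simp add: semisimple_group_def finite_comm_group_def finite_comm_group_axioms_def)
  moreover assume "finitely_generated_subgroup H (wreath_int A)"
  ultimately show "hereditarily_conjugacy_separable ((wreath_int A)\<lparr>carrier := H\<rparr>)"
    by (rule finite_comm_group.hereditarily_conjugacy_separable_fg_subgroup)
next
  fix p :: nat and H
  let ?A = "add_monoid (residue_ring (int p))"
  assume p: "Factorial_Ring.prime p"
  then interpret residues "int p" "residue_ring (int p)"
    by unfold_locales (auto dest: prime_gt_1_nat)
  have "finite_comm_group ?A"
    unfolding finite_comm_group_def finite_comm_group_axioms_def
    using a_comm_group finite by simp
  moreover assume "finitely_generated_subgroup H (wreath_int ?A)"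
  ultimately show "hereditarily_conjugacy_separable ((wreath_int ?A)\<lparr>carrier := H\<rparr>)"
    by (rule finite_comm_group.hereditarily_conjugacy_separable_fg_subgroup)
qed

end
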